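(* Let $n\ge2$, let $\mathbf c\in\mathbb Z_{>0}^n$ be primitive, let $r^2\in\mathbb Z_{>0}$, and put $r=\sqrt{r^2}$. The Knapsack DP described in the context is exact: it computes $\max\{\mathbf c^\top\mathbf x:\mathbf x\in\mathbb Z_{\ge0}^n,\ \lVert\mathbf x\rVert^2\le r^2\}$ as $P(n,r^2)$. It uses $O\left(n(r^2)^{3/2}\right)=O(nr^3)$ arithmetic operations on integers of polynomial bit length. Consequently its bit running time is $O(nr^3)\operatorname{poly}(L)$, where $L=\langle\mathbf c,r^2\rangle$.
   Context: $\lVert\cdot\rVert$ is the Euclidean norm; a vector $\mathbf c\in\mathbb Z^n$ is primitive if $\gcd(c_1,\dots,c_n)=1$. $L=\langle\mathbf c,r^2\rangle$ is the total binary encoding length of $(\mathbf c,r^2)$; $\operatorname{poly}(L)$ denotes an unspecified polynomial factor, and polynomial bit length means polynomial in $L$. Knapsack DP: for $j\in\{0,1,\dots,n\}$ and $b\in\{0,1,\dots,r^2\}$ define $$P(j,b)=\max\Bigl\{\sum_{i=1}^j c_i x_i:\ \sum_{i=1}^j x_i^2\le b,\ x_i\in\mathbb Z_{\ge0}\text{ for all }i\Bigr\}.$$ The algorithm fills the whole table for $j=0,1,\dots,n$ and all $b$, starting from $P(0,b)=0$ for all $b$ and using, for $j\ge1$, $$P(j,b)=\max_{0\le x_j\le\lfloor\sqrt b\rfloor}\bigl[c_jx_j+P(j-1,b-x_j^2)\bigr]$$ with $x_j$ ranging over integers. It stores a maximizing $x_j$ for each state, outputs $P(n,r^2)$, and recovers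 an optimal solution by backtracking from the state $(n,r^2)$. *)

theory Defs
  imports
    "HOL-Analysis.Analysis"
    "HOL-Library.Log_Nat"
    "HOL-Computational_Algebra.Polynomial"
begin

section \<open>Knapsack problem over the nonnegative orthant\<close>

text \<open>
  A vector in \<open>\<int>\<^sup>n\<close> is a function \<open>nat \<Rightarrow> int\<close> of which only the values on \<open>{1..n}\<close> matter.
\<close>

definition primitive :: "nat \<Rightarrow> (nat \<Rightarrow> int) \<Rightarrow> bool" where
  "primitive n c \<longleftrightarrow> Gcd (c ` {1..n}) = 1"

definition objective :: "(nat \<Rightarrow> int) \<Rightarrow> nat \<Rightarrow> (nat \<Rightarrow> int) \<Rightarrow> int" where
  "objective c n x = (\<Sum>i=1..n. c i * x i)"

definition eucl_norm :: "nat \<Rightarrow> (nat \<Rightarrow> int) \<Rightarrow> real" where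
  "eucl_norm n x = L2_set (\<lambda>i. real_of_int (x i)) {1..n}"

definition feasible :: "nat \<Rightarrow> int \<Rightarrow> (nat \<Rightarrow> int) set" where
  "feasible n r2 = {x. (\<forall>i\<in>{1..n}. 0 \<le> x i) \<and> (eucl_norm n x)\<^sup>2 \<le> real_of_int r2}"

definition P :: "(nat \<Rightarrow> int) \<Rightarrow> nat \<Rightarrow> int \<Rightarrow> int" where
  "P c j b = Max {\<Sum>i=1..j. c i * x i | x :: nat \<Rightarrow> int.
                    (\<Sum>i=1..j. (x i)\<^sup>2) \<le> b \<and> (\<forall>i\<in>{1..j}. 0 \<le> x i)}"

text \<open>Binary encoding length: one sign bit plus the binary digits of the absolute value.\<close>

definition bits :: "int \<Rightarrow> nat" where
  "bits z = 1 + nat (bitlen \<bar>z\<bar>)"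

definition enc_length :: "nat \<Rightarrow> (nat \<Rightarrow> int) \<Rightarrow> int \<Rightarrow> nat" where
  "enc_length n c r2 = (\<Sum>i=1..n. bits (c i)) + bits r2"


section \<open>A random access machine with integer registers and arrays\<close>

text \<open>
  Executing a command produces, besides the final state, the list of all elementary steps.
  The operation count and the bit running time are read off from that list.
\<close>

type_synonym name = string

record state =
  reg :: "name \<Rightarrow> int"
  arr :: "name \<Rightarrow> int \<Rightarrow> int"

datatype aexp =
    N int
  | V name
  | Get name aexp
  | Add aexp aexp  (infixl "\<oplus>" 65)
  | Sub aexp aexp  (infixl "\<ominus>" 65)
  | Mul aexp aexp  (infixl "\<otimes>" 70)

datatype bexp =
    Less aexp aexp  (infix "\<prec>" 50)
  | Leq aexp aexp  (infix "\<preceq>" 50)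

datatype com =
    Skip
  | Assign name aexp  ("_ ::= _" [1000, 61] 61)
  | Put name aexp aexp
  | Seq com com  (infixr ";;" 60)
  | If bexp com com  ("(IF _/ THEN _/ ELSE _)" [0, 0, 61] 61)
  | While bexp com  ("(WHILE _/ DO _)" [0, 61] 61)

datatype arith = AddOp | SubOp | MulOp | CmpOp

text \<open>
  \<open>Arith f u v w\<close>: the operation \<open>f\<close> is applied to \<open>u\<close> and \<open>v\<close> with result \<open>w\<close>.
  \<open>Access k v\<close>: the value \<open>v\<close> is read from or written to an array at address \<open>k\<close>.
  \<open>Move v\<close>: \<open>v\<close> is a constant or is read from or written to a register.
\<close>

datatype step = is_Arith: Arith arith int int int | Access int int | Move int

primrec aval :: "aexp \<Rightarrow> state \<Rightarrow> int" where
  "aval (N k) s = k"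
| "aval (V x) s = reg s x"
| "aval (Get a e) s = arr s a (aval e s)"
| "aval (e \<oplus> f) s = aval e s + aval f s"
| "aval (e \<ominus> f) s = aval e s - aval f s"
| "aval (e \<otimes> f) s = aval e s * aval f s"

primrec asteps :: "aexp \<Rightarrow> state \<Rightarrow> step list" where
  "asteps (N k) s = [Move k]"
| "asteps (V x) s = [Move (reg s x)]"
| "asteps (Get a e) s = asteps e s @ [Access (aval e s) (arr s a (aval e s))]"
| "asteps (e \<oplus> f) s =
     asteps e s @ asteps f s @ [Arith AddOp (aval e s) (aval f s) (aval e s + aval f s)]"
| "asteps (e \<ominus> f) s =
     asteps e s @ asteps f s @ [Arith SubOp (aval e s) (aval f s) (aval e s - aval f s)]"
| "asteps (e \<otimes> f) s =
     asteps e s @ asteps f s @ [Arith MulOp (aval e s) (aval f s) (aval e s * aval f s)]"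

primrec bval :: "bexp \<Rightarrow> state \<Rightarrow> bool" where
  "bval (e \<prec> f) s = (aval e s < aval f s)"
| "bval (e \<preceq> f) s = (aval e s \<le> aval f s)"

primrec bsteps :: "bexp \<Rightarrow> state \<Rightarrow> step list" where
  "bsteps (e \<prec> f) s =
     asteps e s @ asteps f s @ [Arith CmpOp (aval e s) (aval f s) (of_bool (aval e s < aval f s))]"
| "bsteps (e \<preceq> f) s =
     asteps e s @ asteps f s @ [Arith CmpOp (aval e s) (aval f s) (of_bool (aval e s \<le> aval f s))]"

definition set_reg :: "name \<Rightarrow> int \<Rightarrow> state \<Rightarrow> state" where
  "set_reg x v s = s\<lparr>reg := (reg s)(x := v)\<rparr>"

definition set_arr :: "name \<Rightarrow> int \<Rightarrow> int \<Rightarrow> state \<Rightarrow> state" where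
  "set_arr a k v s = s\<lparr>arr := (arr s)(a := (arr s a)(k := v))\<rparr>"

text \<open>\<open>exec p s tr t\<close>: started in \<open>s\<close>, \<open>p\<close> terminates in \<open>t\<close> after performing the steps \<open>tr\<close>.\<close>

inductive exec :: "com \<Rightarrow> state \<Rightarrow> step list \<Rightarrow> state \<Rightarrow> bool" where
  Skip: "exec Skip s [] s"
| Assign: "exec (x ::= e) s (asteps e s @ [Move (aval e s)]) (set_reg x (aval e s) s)"
| Put: "exec (Put a k e) s
          (asteps k s @ asteps e s @ [Access (aval k s) (aval e s)])
          (set_arr a (aval k s) (aval e s) s)"
| Seq: "exec p s tr s' \<Longrightarrow> exec q s' tr' t \<Longrightarrow> exec (p ;; q) s (tr @ tr') t"
| IfTrue: "bval g s \<Longrightarrow> exec p s tr t \<Longrightarrow> exec (IF g THEN p ELSE q) s (bsteps g s @ tr) t"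
| IfFalse: "\<not> bval g s \<Longrightarrow> exec q s tr t \<Longrightarrow> exec (IF g THEN p ELSE q) s (bsteps g s @ tr) t"
| WhileFalse: "\<not> bval g s \<Longrightarrow> exec (WHILE g DO p) s (bsteps g s) s"
| WhileTrue: "bval g s \<Longrightarrow> exec p s tr s' \<Longrightarrow> exec (WHILE g DO p) s' tr' t \<Longrightarrow>
                exec (WHILE g DO p) s (bsteps g s @ tr @ tr') t"

inductive_cases exec_SkipE: "exec Skip s tr t"
inductive_cases exec_AssignE: "exec (x ::= e) s tr t"
inductive_cases exec_PutE: "exec (Put a k e) s tr t"
inductive_cases exec_SeqE: "exec (p ;; q) s tr t"
inductive_cases exec_IfE: "exec (IF g THEN p ELSE q) s tr t"
inductive_cases exec_WhileE: "exec (WHILE g DO p) s tr t"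

lemma exec_deterministic:
  "exec p s tr t \<Longrightarrow> exec p s tr' t' \<Longrightarrow> tr' = tr \<and> t' = t"
proof (induction arbitrary: tr' t' rule: exec.induct)
  case (Seq p s tr s' q tr1 t)
  from Seq.prems show ?case by (rule exec_SeqE) (use Seq.IH in blast)
next
  case (WhileTrue g s p tr s' tr1 t)
  from WhileTrue.prems show ?case
    by (rule exec_WhileE) (use WhileTrue.IH WhileTrue.hyps in blast)+
qed (blast elim: exec_SkipE exec_AssignE exec_PutE exec_IfE exec_WhileE)+

definition arith_ops :: "step list \<Rightarrow> nat" where
  "arith_ops tr = length (filter is_Arith tr)"

primrec step_ints :: "step \<Rightarrow> int set" where
  "step_ints (Arith f u v w) = {u, v, w}"
| "step_ints (Access k v) = {k, v}"
| "step_ints (Move v) = {v}"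

text \<open>Logarithmic cost model with schoolbook multiplication.\<close>

primrec step_cost :: "step \<Rightarrow> nat" where
  "step_cost (Arith f u v w) = (if f = MulOp then bits u * bits v else bits u + bits v)"
| "step_cost (Access k v) = bits k + bits v"
| "step_cost (Move v) = bits v"

definition bit_time :: "step list \<Rightarrow> nat" where
  "bit_time tr = sum_list (map step_cost tr)"


section \<open>The dynamic program\<close>

text \<open>
  The two-dimensional tables are stored row by row in one-dimensional arrays: the entry for
  \<open>(j, b)\<close> is at address \<open>j * (r2 + 1) + b\<close>, and the address arithmetic is part of the program.
\<close>

abbreviation (input) cell :: "aexp \<Rightarrow> aexp \<Rightarrow> aexp" where
  "cell j b \<equiv> j \<otimes> V ''width'' \<oplus> b"

definition init_row :: com where
  "init_row =
     ''b'' ::= N 0 ;;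
     WHILE V ''b'' \<preceq> V ''r2'' DO (
       Put ''P'' (cell (N 0) (V ''b'')) (N 0) ;;
       ''b'' ::= V ''b'' \<oplus> N 1)"

text \<open>
  The maximum in the recurrence is taken over \<open>x = 0, 1, 2, \<dots>\<close> as long as \<open>x * x \<le> b\<close>, that is, up
  to \<open>\<lfloor>sqrt b\<rfloor>\<close>; the candidate for \<open>x = 0\<close> is \<open>P(j - 1, b)\<close>.
\<close>

definition fill_state :: com where
  "fill_state =
     ''best'' ::= Get ''P'' (cell (V ''j'' \<ominus> N 1) (V ''b'')) ;;
     ''arg'' ::= N 0 ;;
     ''x'' ::= N 1 ;;
     WHILE V ''x'' \<otimes> V ''x'' \<preceq> V ''b'' DO (
       ''v'' ::= Get ''c'' (V ''j'') \<otimes> V ''x''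
                 \<oplus> Get ''P'' (cell (V ''j'' \<ominus> N 1) (V ''b'' \<ominus> V ''x'' \<otimes> V ''x'')) ;;
       IF V ''best'' \<prec> V ''v''
         THEN (''best'' ::= V ''v'' ;; ''arg'' ::= V ''x'')
         ELSE Skip ;;
       ''x'' ::= V ''x'' \<oplus> N 1) ;;
     Put ''P'' (cell (V ''j'') (V ''b'')) (V ''best'') ;;
     Put ''X'' (cell (V ''j'') (V ''b'')) (V ''arg'')"

definition fill_table :: com where
  "fill_table =
     ''j'' ::= N 1 ;;
     WHILE V ''j'' \<preceq> V ''n'' DO (
       ''b'' ::= N 0 ;;
       WHILE V ''b'' \<preceq> V ''r2'' DO (
         fill_state ;;
         ''b'' ::= V ''b'' \<oplus> N 1) ;;
       ''j'' ::= V ''j'' \<oplus> N 1)"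

definition backtrack :: com where
  "backtrack =
     ''j'' ::= V ''n'' ;;
     ''b'' ::= V ''r2'' ;;
     WHILE N 1 \<preceq> V ''j'' DO (
       ''x'' ::= Get ''X'' (cell (V ''j'') (V ''b'')) ;;
       Put ''sol'' (V ''j'') (V ''x'') ;;
       ''b'' ::= V ''b'' \<ominus> V ''x'' \<otimes> V ''x'' ;;
       ''j'' ::= V ''j'' \<ominus> N 1)"

definition knapsack_dp :: com where
  "knapsack_dp =
     ''width'' ::= V ''r2'' \<oplus> N 1 ;;
     init_row ;;
     fill_table ;;
     ''opt'' ::= Get ''P'' (cell (V ''n'') (V ''r2'')) ;;
     backtrack"

definition input :: "nat \<Rightarrow> (nat \<Rightarrow> int) \<Rightarrow> int \<Rightarrow> state" where
  "input n c r2 =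
     \<lparr>reg = (\<lambda>_. 0)(''n'' := int n, ''r2'' := r2),
      arr = (\<lambda>_ _. 0)(''c'' := (\<lambda>k. if 1 \<le> k \<and> k \<le> int n then c (nat k) else 0))\<rparr>"

definition table :: "int \<Rightarrow> state \<Rightarrow> nat \<Rightarrow> int \<Rightarrow> int" where
  "table r2 t j b = arr t ''P'' (int j * (r2 + 1) + b)"

definition optimum :: "state \<Rightarrow> int" where
  "optimum t = reg t ''opt''"

definition solution :: "state \<Rightarrow> nat \<Rightarrow> int" where
  "solution t i = arr t ''sol'' (int i)"

end

(*
  Bellman's equation for P reduces exactness to the invariant that every table cell written so far
  holds its value of P together with a maximizer, and backtracking keeps
  P(j, b) + (value collected so far) constant. There are n (r^2 + 1) cells, and for each of them
  the inner loop makes at most floor (sqrt b) <= r rounds of constantly many steps, hence O(n r^3)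
  steps. Every integer that occurs is at most (c_1 + ... + c_n + n + 2) (r^2 + 1)^2 in absolute
  value, so its bit length is linear in L, and a step costs at most quadratically many bit
  operations in that length.
*)
theory Submission
  imports Defs "HOL-Library.Discrete_Functions"
begin

section \<open>Weakest preconditions with step counts\<close>

text \<open>Exactness, the number of operations and the bit lengths are claims about one and the
  same execution trace. Hence \<open>wp\<close> asserts them together: a terminating run exists, no
  integer in its trace exceeds \<open>M\<close> in absolute value, and the postcondition sees the
  length of the trace along with the final state. Each loop is then analysed once instead of three
  times. By \<open>exec_deterministic\<close> the run whose existence is shown is the only one. All
  steps are counted, not just arithmetic ones, because moves and array accesses also cost bit time;
  the total bounds the number of arithmetic operations. Since every intermediate value has to be
  bounded, feasibility enters even the size estimate: a candidate of the recurrence is the value of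
  a feasible vector and therefore never exceeds the optimum of its cell.\<close>

definition bounded_steps :: "int \<Rightarrow> step list \<Rightarrow> bool" where
  "bounded_steps M tr \<longleftrightarrow> (\<forall>e\<in>set tr. \<forall>z\<in>step_ints e. \<bar>z\<bar> \<le> M)"

lemma bounded_steps_simps [simp]:
  "bounded_steps M []"
  "bounded_steps M (e # tr) \<longleftrightarrow> (\<forall>z\<in>step_ints e. \<bar>z\<bar> \<le> M) \<and> bounded_steps M tr"
  "bounded_steps M (tr @ tr') \<longleftrightarrow> bounded_steps M tr \<and> bounded_steps M tr'"
  by (auto simp: bounded_steps_def)

definition wp :: "int \<Rightarrow> com \<Rightarrow> (nat \<Rightarrow> state \<Rightarrow> bool) \<Rightarrow> state \<Rightarrow> bool" where
  "wp M p Q s \<longleftrightarrow> (\<exists>tr t. exec p s tr t \<and> bounded_steps M tr \<and> Q (length tr) t)"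

lemma wp_mono:
  assumes "wp M p Q s" "\<And>m t. Q m t \<Longrightarrow> Q' m t"
  shows "wp M p Q' s"
  using assms unfolding wp_def by blast

lemma wp_Skip: "wp M Skip Q s \<longleftrightarrow> Q 0 s"
  unfolding wp_def by (metis exec.Skip exec_SkipE bounded_steps_simps(1) list.size(3))

lemma wp_Assign:
  "wp M (x ::= e) Q s \<longleftrightarrow> bounded_steps M (asteps e s) \<and> \<bar>aval e s\<bar> \<le> M \<and>
     Q (length (asteps e s) + 1) (set_reg x (aval e s) s)"
  unfolding wp_def by (force intro: exec.Assign elim!: exec_AssignE)

lemma wp_Put:
  "wp M (Put a k e) Q s \<longleftrightarrow> bounded_steps M (asteps k s) \<and> bounded_steps M (asteps e s) \<and>
     \<bar>aval k s\<bar> \<le> M \<and> \<bar>aval e s\<bar> \<le> M \<and>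
     Q (length (asteps k s) + length (asteps e s) + 1) (set_arr a (aval k s) (aval e s) s)"
  unfolding wp_def by (force intro: exec.Put elim!: exec_PutE)

lemma wp_Seq: "wp M (p ;; q) Q s \<longleftrightarrow> wp M p (\<lambda>k. wp M q (\<lambda>m. Q (k + m))) s"
proof
  assume "wp M (p ;; q) Q s"
  then show "wp M p (\<lambda>k. wp M q (\<lambda>m. Q (k + m))) s"
    unfolding wp_def by (fastforce elim!: exec_SeqE)
next
  assume "wp M p (\<lambda>k. wp M q (\<lambda>m. Q (k + m))) s"
  then obtain tr s' tr' t where "exec p s tr s'" "bounded_steps M tr" "exec q s' tr' t"
    "bounded_steps M tr'" "Q (length tr + length tr') t"
    unfolding wp_def by blast
  then show "wp M (p ;; q) Q s"
    unfolding wp_def by (intro exI[of _ "tr @ tr'"] exI[of _ t]) (auto intro: exec.Seq)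
qed

lemma wp_If:
  "wp M (IF g THEN p ELSE q) Q s \<longleftrightarrow> bounded_steps M (bsteps g s) \<and>
     wp M (if bval g s then p else q) (\<lambda>m. Q (length (bsteps g s) + m)) s"
proof
  assume "wp M (IF g THEN p ELSE q) Q s"
  then show "bounded_steps M (bsteps g s) \<and>
     wp M (if bval g s then p else q) (\<lambda>m. Q (length (bsteps g s) + m)) s"
    unfolding wp_def by (fastforce elim!: exec_IfE)
next
  assume *: "bounded_steps M (bsteps g s) \<and>
     wp M (if bval g s then p else q) (\<lambda>m. Q (length (bsteps g s) + m)) s"
  then obtain tr t where "exec (if bval g s then p else q) s tr t" "bounded_steps M tr"
    "Q (length (bsteps g s) + length tr) t"
    unfolding wp_def by blast
  with * show "wp M (IF g THEN p ELSE q) Q s"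
    unfolding wp_def
    by (intro exI[of _ "bsteps g s @ tr"] exI[of _ t])
      (auto intro: exec.IfTrue exec.IfFalse split: if_splits)
qed

lemmas wp_simps = wp_Skip wp_Assign wp_Put wp_Seq wp_If

text \<open>\<open>I k\<close> is the invariant after \<open>k\<close> rounds. The number
  \<open>L\<close> of rounds is exact and fixed beforehand, so the induction goes down from
  \<open>L\<close> and yields termination as well. The guard is evaluated \<open>L + 1\<close>
  times, hence the last summand \<open>G\<close>.\<close>

lemma wp_While_count:
  assumes init: "I 0 s"
    and step: "\<And>k s. k < L \<Longrightarrow> I k s \<Longrightarrow>
      bval g s \<and> bounded_steps M (bsteps g s) \<and> wp M p (\<lambda>m t. m \<le> T \<and> I (Suc k) t) s"
    and exit: "\<And>s. I L s \<Longrightarrow> \<not> bval g s \<and> bounded_steps M (bsteps g s)"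
    and guard: "\<And>s. length (bsteps g s) \<le> G"
    and post: "\<And>m t. m \<le> L * (T + G) + G \<Longrightarrow> I L t \<Longrightarrow> Q m t"
  shows "wp M (WHILE g DO p) Q s"
proof -
  have "wp M (WHILE g DO p) (\<lambda>m t. m \<le> (L - k) * (T + G) + G \<and> I L t) s" if "k \<le> L" "I k s" for k s
    using that
  proof (induction k arbitrary: s rule: inc_induct)
    case base
    have "exec (WHILE g DO p) s (bsteps g s) s" "bounded_steps M (bsteps g s)"
      using exit[OF base] by (auto intro: exec.WhileFalse)
    with base show ?case using guard unfolding wp_def by fastforce
  next
    case (step k)
    note g = assms(2)[OF step.hyps(2) step.prems]
    then obtain tr s' where 1: "exec p s tr s'" "bounded_steps M tr" "length tr \<le> T" "I (Suc k) s'"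
      unfolding wp_def by blast
    from step.IH[OF 1(4)] obtain tr' t where 2: "exec (WHILE g DO p) s' tr' t"
      "bounded_steps M tr'" "length tr' \<le> (L - Suc k) * (T + G) + G" "I L t"
      unfolding wp_def by blast
    have "L - k = Suc (L - Suc k)" using step.hyps by simp
    then have "length (bsteps g s @ tr @ tr') \<le> (L - k) * (T + G) + G"
      using 1(3) 2(3) guard[of s] by simp
    moreover have "exec (WHILE g DO p) s (bsteps g s @ tr @ tr') t"
      using exec.WhileTrue g 1 2 by blast
    ultimately show ?case
      unfolding wp_def using g 1 2 by (intro exI[of _ "bsteps g s @ tr @ tr'"] exI[of _ t]) simp
  qed
  from this[OF _ init] show ?thesis by (rule wp_mono) (use post in auto)
qed

lemma reg_set_reg [simp]: "reg (set_reg x v s) y = (if y = x then v else reg s y)"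
  and arr_set_reg [simp]: "arr (set_reg x v s) = arr s"
  and reg_set_arr [simp]: "reg (set_arr a k v s) = reg s"
  and arr_set_arr [simp]:
    "arr (set_arr a k v s) a' k' = (if a' = a \<and> k' = k then v else arr s a' k')"
  by (auto simp: set_reg_def set_arr_def)


section \<open>The Bellman equation\<close>

definition fits :: "nat \<Rightarrow> int \<Rightarrow> (nat \<Rightarrow> int) \<Rightarrow> bool" where
  "fits j b x \<longleftrightarrow> (\<Sum>i=1..j. (x i)\<^sup>2) \<le> b \<and> (\<forall>i\<in>{1..j}. 0 \<le> x i)"

lemma P_alt: "P c j b = Max (objective c j ` Collect (fits j b))"
  unfolding P_def fits_def objective_def by (rule arg_cong[of _ _ Max]) auto

text \<open>A square is at most the sum of all squares, and a nonnegative integer is at most its own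
  square. The coarse bound \<open>b\<close> in place of its root suffices for finiteness and for bit
  lengths.\<close>

lemma fits_le:
  assumes "fits j b x" "i \<in> {1..j}"
  shows "x i \<le> b" "x i * x i \<le> b"
proof -
  have "(x i)\<^sup>2 \<le> (\<Sum>i=1..j. (x i)\<^sup>2)"
    using assms(2) by (intro member_le_sum) auto
  also have "\<dots> \<le> b" using assms by (simp add: fits_def)
  finally show *: "x i * x i \<le> b" by (simp add: power2_eq_square)
  have "x i \<le> x i * x i"
    using assms by (cases "x i = 0") (auto simp: fits_def mult_le_cancel_left1)
  with * show "x i \<le> b" by linarith
qed

lemma objective_bounds:
  assumes "fits j b x" "\<forall>i\<in>{1..j}. 0 \<le> c i"
  shows "0 \<le> objective c j x" "objective c j x \<le> (\<Sum>i=1..j. c i) * b"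
proof -
  show "0 \<le> objective c j x"
    using assms unfolding objective_def fits_def by (intro sum_nonneg) auto
  show "objective c j x \<le> (\<Sum>i=1..j. c i) * b"
    unfolding objective_def sum_distrib_right
    using assms fits_le(1) by (intro sum_mono mult_left_mono) auto
qed

text \<open>There may be infinitely many admissible \<open>x\<close>, as their values outside
  \<open>{1..j}\<close> are unconstrained. Only the objective values form a finite set, and the
  \<open>Max\<close> in \<open>P\<close> ranges over these.\<close>

lemma finite_objective:
  assumes "\<forall>i\<in>{1..j}. 0 \<le> c i"
  shows "finite (objective c j ` Collect (fits j b))"
proof (rule finite_subset)
  show "objective c j ` Collect (fits j b) \<subseteq> {0..(\<Sum>i=1..j. c i) * b}"
    using objective_bounds[OF _ assms] by (metis CollectD atLeastAtMost_iff image_subsetI)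
qed simp

lemma fits_zero: "0 \<le> b \<Longrightarrow> fits j b (\<lambda>_. 0)"
  by (simp add: fits_def)

lemma P_upper:
  assumes "\<forall>i\<in>{1..j}. 0 \<le> c i" "fits j b x"
  shows "objective c j x \<le> P c j b"
  unfolding P_alt using assms finite_objective by (intro Max_ge) auto

lemma P_attained:
  assumes "\<forall>i\<in>{1..j}. 0 \<le> c i" "0 \<le> b"
  obtains x where "fits j b x" "objective c j x = P c j b"
proof -
  have "P c j b \<in> objective c j ` Collect (fits j b)"
    unfolding P_alt using finite_objective[OF assms(1)] fits_zero[OF assms(2)] by (intro Max_in) auto
  then show ?thesis using that by (elim imageE) simp
qed

lemma P_bounds:
  assumes "\<forall>i\<in>{1..j}. 0 \<le> c i" "0 \<le> b"
  shows "0 \<le> P c j b" "P c j b \<le> (\<Sum>i=1..j. c i) * b"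
proof -
  obtain x where x: "fits j b x" "objective c j x = P c j b"
    by (rule P_attained[OF assms])
  show "0 \<le> P c j b" "P c j b \<le> (\<Sum>i=1..j. c i) * b"
    using objective_bounds[OF x(1) assms(1)] unfolding x(2) .
qed

lemma P_0: "0 \<le> b \<Longrightarrow> P c 0 b = 0"
  using P_bounds[of 0 c b] by (intro antisym) simp_all

text \<open>One half of Bellman's equation: an optimal vector for the residual budget is extended by
  the coordinate \<open>x\<close>, which uses up \<open>x * x\<close> of the budget.\<close>

lemma P_Suc_upper:
  assumes "\<forall>i\<in>{1..Suc j}. 0 \<le> c i" "0 \<le> x" "x * x \<le> b"
  shows "c (Suc j) * x + P c j (b - x * x) \<le> P c (Suc j) b"
proof -
  have nn: "\<forall>i\<in>{1..j}. 0 \<le> c i" using assms(1) by (meson atLeastAtMost_iff le_SucI)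
  obtain y where y: "fits j (b - x * x) y" "objective c j y = P c j (b - x * x)"
    by (rule P_attained[OF nn, of "b - x * x"]) (use assms in auto)
  let ?z = "y(Suc j := x)"
  have z: "fits (Suc j) b ?z"
    using y(1) assms(2) unfolding fits_def by (auto simp: power2_eq_square)
  have "objective c (Suc j) ?z = c (Suc j) * x + objective c j y"
    by (simp add: objective_def)
  with P_upper[OF assms(1) z] y(2) show ?thesis by linarith
qed

text \<open>The other half: dropping the last coordinate of an optimal vector leaves one that fits
  the residual budget.\<close>

lemma P_Suc_attained:
  assumes "\<forall>i\<in>{1..Suc j}. 0 \<le> c i" "0 \<le> b"
  obtains x where "0 \<le> x" "x * x \<le> b" "P c (Suc j) b \<le> c (Suc j) * x + P c j (b - x * x)"
proof -
  have nn: "\<forall>i\<in>{1..j}. 0 \<le> c i" using assms(1) by (meson atLeastAtMost_iff le_SucI)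
  obtain y where y: "fits (Suc j) b y" "objective c (Suc j) y = P c (Suc j) b"
    by (rule P_attained[OF assms])
  let ?x = "y (Suc j)"
  have "fits j (b - ?x * ?x) y"
    using y(1) unfolding fits_def by (auto simp: power2_eq_square)
  from P_upper[OF nn this] have "P c (Suc j) b \<le> c (Suc j) * ?x + P c j (b - ?x * ?x)"
    using y(2) by (simp add: objective_def)
  then show ?thesis
    by (rule that[rotated 2]) (use y(1) fits_le(2)[OF y(1)] in \<open>simp_all add: fits_def\<close>)
qed

text \<open>Squaring the norm removes the root, so the real constraint is the image of an integer
  one.\<close>

lemma feasible_eq: "feasible n r2 = Collect (fits n r2)"
proof -
  have "(eucl_norm n x)\<^sup>2 = real_of_int (\<Sum>i=1..n. (x i)\<^sup>2)" for x
    unfolding eucl_norm_def L2_set_def by (simp add: sum_nonneg)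
  then show ?thesis
    unfolding feasible_def fits_def of_int_le_iff by (auto simp only:)
qed


section \<open>Correctness and running time of the program\<close>

locale knapsack =
  fixes n :: nat and c :: "nat \<Rightarrow> int" and r2 :: int
  assumes c_pos: "\<forall>i\<in>{1..n}. 0 < c i" and r2_pos: "0 < r2"
begin

section \<open>Size of the integers in a run\<close>

definition width :: int where
  "width = r2 + 1"

text \<open>One product that dominates every kind of integer: addresses and counters stay below
  \<open>(int n + 1) * width\<close>, table values below \<open>(\<Sum>i=1..n. c i) * width\<close>,
  and squares reach at most \<open>width * width\<close>.\<close>

definition max_int :: int where
  "max_int = ((\<Sum>i=1..n. c i) + int n + 2) * width\<^sup>2"

lemma c_nonneg: "j \<le> n \<Longrightarrow> \<forall>i\<in>{1..j}. 0 \<le> c i"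
  using c_pos by (meson atLeastAtMost_iff le_trans less_imp_le)

lemma sum_c_nonneg: "0 \<le> (\<Sum>i=1..n. c i)"
  using c_nonneg[OF order_refl] by (intro sum_nonneg) auto

lemma le_max_int:
  assumes "z \<le> k * width\<^sup>2" "k \<le> (\<Sum>i=1..n. c i) + int n + 2"
  shows "z \<le> max_int"
  using assms mult_right_mono[OF assms(2), of "width\<^sup>2"] by (simp add: max_int_def)

lemma width_le_square: "width \<le> width\<^sup>2"
  using r2_pos by (intro self_le_power) (auto simp: width_def)

lemma max_int_lin: "z \<le> k * width \<Longrightarrow> 0 \<le> k \<Longrightarrow> k \<le> (\<Sum>i=1..n. c i) + int n + 2 \<Longrightarrow> z \<le> max_int"
  using mult_left_mono[OF width_le_square, of k] le_max_int[of z k] by linarith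

lemma max_int_width: "z \<le> width \<Longrightarrow> z \<le> max_int"
  using max_int_lin[of z 1] sum_c_nonneg by simp

lemma max_int_index:
  assumes "z \<le> int n + 1"
  shows "z \<le> max_int"
proof (rule max_int_lin)
  have "1 \<le> width" using r2_pos by (simp add: width_def)
  then have "int n + 1 \<le> (int n + 1) * width" by (simp add: mult_le_cancel_left1)
  with assms show "z \<le> (int n + 1) * width" by (rule order_trans)
qed (use sum_c_nonneg in auto)

lemma max_int_square: "0 \<le> x \<Longrightarrow> x \<le> width \<Longrightarrow> x * x \<le> max_int"
  using le_max_int[of "x * x" 1] power_mono[of x width 2] sum_c_nonneg
  by (simp add: power2_eq_square)

lemma max_int_addr: "j \<le> n \<Longrightarrow> b \<le> r2 \<Longrightarrow> int j * width + b \<le> max_int"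
  using max_int_lin[of "int j * width + b" "int j + 1"] sum_c_nonneg
  by (simp add: width_def algebra_simps)

lemma max_int_value: "z \<le> (\<Sum>i=1..n. c i) * r2 \<Longrightarrow> z \<le> max_int"
  using max_int_lin[of z "\<Sum>i=1..n. c i"] sum_c_nonneg
  by (simp add: width_def algebra_simps)

lemma max_int_coeff: "i \<in> {1..n} \<Longrightarrow> c i \<le> max_int"
proof (rule max_int_value)
  assume i: "i \<in> {1..n}"
  then have "c i \<le> (\<Sum>i=1..n. c i)"
    using c_nonneg[OF order_refl] by (intro member_le_sum) auto
  also have "\<dots> \<le> (\<Sum>i=1..n. c i) * r2"
    using sum_c_nonneg r2_pos by (simp add: mult_le_cancel_left1)
  finally show "c i \<le> (\<Sum>i=1..n. c i) * r2" .
qed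

section \<open>Maximizers of the recurrence and the layout of the table\<close>

definition cand :: "nat \<Rightarrow> int \<Rightarrow> int \<Rightarrow> int" where
  "cand j b x = c j * x + P c (j - 1) (b - x * x)"

definition choice :: "nat \<Rightarrow> int \<Rightarrow> int \<Rightarrow> bool" where
  "choice j b x \<longleftrightarrow> 0 \<le> x \<and> x * x \<le> b \<and> cand j b x = P c j b"

lemma sum_c_mono: "j \<le> n \<Longrightarrow> (\<Sum>i=1..j. c i) \<le> (\<Sum>i=1..n. c i)"
  using c_nonneg[OF order_refl] by (intro sum_mono2) auto

lemma P_le:
  assumes "j \<le> n" "0 \<le> b" "b \<le> r2"
  shows "0 \<le> P c j b" "P c j b \<le> (\<Sum>i=1..n. c i) * r2"
proof -
  show "0 \<le> P c j b" using P_bounds(1)[OF c_nonneg] assms by simp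
  have "P c j b \<le> (\<Sum>i=1..j. c i) * b" using P_bounds(2)[OF c_nonneg] assms by simp
  also have "\<dots> \<le> (\<Sum>i=1..n. c i) * r2"
    using assms sum_c_mono sum_c_nonneg by (intro mult_mono) auto
  finally show "P c j b \<le> (\<Sum>i=1..n. c i) * r2" .
qed

lemma le_square: "0 \<le> (x::int) \<Longrightarrow> x \<le> x * x"
  by (cases "x = 0") (auto simp: mult_le_cancel_left1)

lemma cand_le:
  assumes "1 \<le> j" "j \<le> n" "0 \<le> x" "x * x \<le> b"
  shows "cand j b x \<le> P c j b"
proof -
  obtain i where j: "j = Suc i" using assms(1) by (cases j) auto
  show ?thesis
    using P_Suc_upper[OF c_nonneg assms(3,4), of i] assms(2) unfolding j cand_def by simp
qed

text \<open>\<open>P_Suc_attained\<close> supplies some candidate that reaches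
  \<open>P c j b\<close>, so one that dominates all others reaches it too; by \<open>cand_le\<close>
  it cannot exceed it.\<close>

lemma choiceI:
  assumes "1 \<le> j" "j \<le> n" "0 \<le> x" "x * x \<le> b"
    "\<And>y. 0 \<le> y \<Longrightarrow> y * y \<le> b \<Longrightarrow> cand j b y \<le> cand j b x"
  shows "choice j b x"
proof -
  obtain i where j: "j = Suc i" using assms(1) by (cases j) auto
  have "0 \<le> b" using assms(3,4) le_square[OF assms(3)] by linarith
  then obtain y where "0 \<le> y" "y * y \<le> b" "P c j b \<le> cand j b y"
    using P_Suc_attained[OF c_nonneg[of "Suc i"], of b] assms(2) unfolding j cand_def diff_Suc_1
    by metis
  with assms(5) have "P c j b \<le> cand j b x" by fastforce
  with cand_le[OF assms(1-4)] assms(3,4) show ?thesis unfolding choice_def by simp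
qed

text \<open>
  The program writes the cells in the order of their addresses, so its progress is recorded by a
  single address bound \<open>A\<close>.
\<close>

definition filled :: "int \<Rightarrow> state \<Rightarrow> bool" where
  "filled A s \<longleftrightarrow> (\<forall>j b. 0 \<le> b \<longrightarrow> b \<le> r2 \<longrightarrow> int j * width + b < A \<longrightarrow>
     arr s ''P'' (int j * width + b) = P c j b \<and>
     (1 \<le> j \<longrightarrow> choice j b (arr s ''X'' (int j * width + b))))"

lemma filledD:
  assumes "filled A s" "0 \<le> b" "b \<le> r2" "int j * width + b < A"
  shows "arr s ''P'' (int j * width + b) = P c j b"
    "1 \<le> j \<Longrightarrow> choice j b (arr s ''X'' (int j * width + b))"
  using assms unfolding filled_def by blast+

text \<open>Row and column are the quotient and the remainder of the address modulo
  \<open>width\<close>, because \<open>r2 < width\<close>.\<close>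

lemma addr_inj:
  assumes "int j * width + b = int j' * width + b'" "0 \<le> b" "b \<le> r2" "0 \<le> b'" "b' \<le> r2"
  shows "j = j' \<and> b = b'"
proof -
  have "(int j * width + b) div width = int j" "(int j * width + b) mod width = b"
    "(int j' * width + b') div width = int j'" "(int j' * width + b') mod width = b'"
    using assms(2-) by (auto simp: width_def)
  with assms(1) show ?thesis by simp
qed

definition base :: "state \<Rightarrow> bool" where
  "base s \<longleftrightarrow> reg s ''n'' = int n \<and> reg s ''r2'' = r2 \<and> reg s ''width'' = width \<and>
     (\<forall>i\<in>{1..n}. arr s ''c'' (int i) = c i)"

text \<open>By \<open>addr_inj\<close> only the cell \<open>(j, b)\<close> has the new address. The
  state \<open>t\<close> is described by its arrays alone, so the lemma covers row 0, where no
  maximizer is stored, as well as the later rows.\<close>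

lemma filled_extend:
  assumes "filled (int j * width + b) s" "0 \<le> b" "b \<le> r2"
    "\<And>k. k \<noteq> int j * width + b \<Longrightarrow> arr t ''P'' k = arr s ''P'' k \<and> arr t ''X'' k = arr s ''X'' k"
    "arr t ''P'' (int j * width + b) = P c j b"
    "1 \<le> j \<Longrightarrow> choice j b (arr t ''X'' (int j * width + b))"
  shows "filled (int j * width + b + 1) t"
  unfolding filled_def
proof (intro allI impI)
  fix j' b' assume b': "0 \<le> b'" "b' \<le> r2" and less: "int j' * width + b' < int j * width + b + 1"
  show "arr t ''P'' (int j' * width + b') = P c j' b' \<and>
    (1 \<le> j' \<longrightarrow> choice j' b' (arr t ''X'' (int j' * width + b')))"
  proof (cases "int j' * width + b' = int j * width + b")
    case True
    then have "j' = j \<and> b' = b" using addr_inj b' assms(2,3) by blast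
    then show ?thesis using assms(5,6) by auto
  next
    case False
    with less filledD[OF assms(1) b', of j'] assms(4)[OF False] show ?thesis by simp
  qed
qed

section \<open>Filling a single cell\<close>

definition at_state :: "nat \<Rightarrow> int \<Rightarrow> int \<Rightarrow> state \<Rightarrow> bool" where
  "at_state j b A s \<longleftrightarrow> base s \<and> reg s ''j'' = int j \<and> reg s ''b'' = b \<and> filled A s"


lemma filled_set_reg [simp]: "filled A (set_reg x v s) = filled A s"
  by (simp add: filled_def)

lemma base_set_reg [simp]:
  "x \<notin> {''n'', ''r2'', ''width''} \<Longrightarrow> base (set_reg x v s) = base s"
  by (auto simp: base_def)

lemma base_set_arr [simp]: "a \<noteq> ''c'' \<Longrightarrow> base (set_arr a k v s) = base s"
  by (simp add: base_def)

lemma at_state_set_reg [simp]: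
  "x \<notin> {''n'', ''r2'', ''width'', ''j'', ''b''} \<Longrightarrow>
    at_state j b A (set_reg x v s) = at_state j b A s"
  by (auto simp: at_state_def)

text \<open>The two inequalities make \<open>w\<close> the integer part of the root of
  \<open>b\<close>, which is the exact number of rounds of the inner loop.\<close>

lemma fill_state_wp:
  assumes j: "1 \<le> j" "j \<le> n" and b: "0 \<le> b" "b \<le> r2"
    and w: "int w * int w \<le> b" "b < (int w + 1) * (int w + 1)"
    and s: "at_state j b (int j * width + b) s"
  shows "wp max_int fill_state
    (\<lambda>m t. m \<le> 100 * (w + 1) \<and> at_state j b (int j * width + b + 1) t) s"
proof -
  let ?A = "int j * width + b"
  \<comment> \<open>The candidate for 0 is taken before the loop, so after \<open>k\<close> rounds
    the \<open>k + 1\<close> values from 0 to \<open>k\<close> have been compared and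
    \<open>x\<close> is already \<open>k + 1\<close>.\<close>
  define I where "I = (\<lambda>k s. at_state j b ?A s \<and> reg s ''x'' = int k + 1 \<and>
    0 \<le> reg s ''arg'' \<and> reg s ''arg'' \<le> int k \<and> reg s ''best'' = cand j b (reg s ''arg'') \<and>
    (\<forall>x. 0 \<le> x \<longrightarrow> x \<le> int k \<longrightarrow> cand j b x \<le> reg s ''best''))"
  have int_j: "int (j - 1) = int j - 1" using j by simp
  have width: "0 < width" using r2_pos by (simp add: width_def)
  \<comment> \<open>From \<open>b' \<le> b\<close> and \<open>0 < width\<close>, the cell in row
    \<open>j - 1\<close> has an address before the current one, so it holds its final value.\<close>
  have prev: "arr s ''P'' ((int j - 1) * width + b') = P c (j - 1) b'"
    if "at_state j b ?A s" "0 \<le> b'" "b' \<le> b" for s b'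
  proof -
    have "(int j - 1) * width + b' < ?A"
      using that b width by (simp add: left_diff_distrib)
    then show ?thesis
      using filledD(1)[of ?A s b' "j - 1"] that b unfolding at_state_def int_j by simp
  qed
  have cj: "arr s ''c'' (int j) = c j" if "at_state j b ?A s" for s
    using that j by (simp add: at_state_def base_def)
  have addr: "0 \<le> int j' * width" "int j' * width \<le> max_int" "0 \<le> int j' * width + b'"
    "int j' * width + b' \<le> max_int" if "j' \<le> n" "0 \<le> b'" "b' \<le> r2" for j' b'
    using that width max_int_addr[OF that(1), of 0] max_int_addr[OF that(1,3)] r2_pos by auto
  have addr1: "\<bar>(int j - 1) * width\<bar> \<le> max_int" "\<bar>(int j - 1) * width + b'\<bar> \<le> max_int"
    if "0 \<le> b'" "b' \<le> r2" for b'
    using addr[of "j - 1" b'] j that unfolding int_j by auto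
  have addr0: "\<bar>int j * width\<bar> \<le> max_int" "\<bar>?A\<bar> \<le> max_int"
    using addr[of j b] j b by auto
  have le: "\<bar>z\<bar> \<le> max_int" if "0 \<le> z" "z \<le> width" for z
    using that max_int_width by simp
  have sq: "\<bar>x * x\<bar> \<le> max_int" if "0 \<le> x" "x \<le> width" for x
    using that max_int_square by simp
  have w_le: "int w \<le> r2"
    using w(1) b le_square[of "int w"] by linarith
  have j1: "j - 1 \<le> n" and j0: "\<bar>1\<bar> \<le> max_int" "\<bar>0\<bar> \<le> max_int" "\<bar>int j\<bar> \<le> max_int" "\<bar>int j - 1\<bar> \<le> max_int"
    "\<bar>width\<bar> \<le> max_int" "\<bar>b\<bar> \<le> max_int"
    using j b width max_int_index[of "int j"] max_int_index[of "int j - 1"] le[of 0] le[of 1] le[of width] le[of b]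
    by (auto simp: width_def)
  have bP: "\<bar>P c j' b'\<bar> \<le> max_int" if "j' \<le> n" "0 \<le> b'" "b' \<le> r2" for j' b'
    using P_le[OF that] max_int_value by simp
  have step: "bval (V ''x'' \<otimes> V ''x'' \<preceq> V ''b'') s \<and>
      bounded_steps max_int (bsteps (V ''x'' \<otimes> V ''x'' \<preceq> V ''b'') s) \<and>
      wp max_int (''v'' ::= Get ''c'' (V ''j'') \<otimes> V ''x''
                 \<oplus> Get ''P'' (cell (V ''j'' \<ominus> N 1) (V ''b'' \<ominus> V ''x'' \<otimes> V ''x'')) ;;
       IF V ''best'' \<prec> V ''v''
         THEN (''best'' ::= V ''v'' ;; ''arg'' ::= V ''x'')
         ELSE Skip ;;
       ''x'' ::= V ''x'' \<oplus> N 1) (\<lambda>m t. m \<le> 50 \<and> I (Suc k) t) s" if k: "k < w" and I: "I k s" for k s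
  proof -
    define X where "X = reg s ''x''"
    have X: "0 \<le> X" "X \<le> int w" "X = int k + 1" using I k by (auto simp: I_def X_def)
    have XX: "X * X \<le> b" using mult_mono[OF X(2) X(2)] X(1) w(1) by linarith
    have XX0: "0 \<le> X * X" using X by simp
    have st: "at_state j b ?A s" using I by (simp add: I_def)
    have regs: "reg s ''x'' = X" "reg s ''j'' = int j" "reg s ''b'' = b" "reg s ''width'' = width"
      "reg s ''best'' = cand j b (reg s ''arg'')"
      using I by (simp_all add: I_def at_state_def base_def X_def)
    have b': "0 \<le> b - X * X" "b - X * X \<le> r2" using XX XX0 b by linarith+
    have p: "arr s ''P'' ((int j - 1) * width + (b - X * X)) = P c (j - Suc 0) (b - X * X)"
      "P c (j - 1) (b - X * X) = P c (j - Suc 0) (b - X * X)" using prev[OF st] XX XX0 by simp_all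
    have nonneg: "0 \<le> c j" using c_pos j by (simp add: less_imp_le)
    \<comment> \<open>A candidate lies below the optimum \<open>P c j b\<close> of its cell, and the
      product \<open>c j * x\<close> lies below the candidate because \<open>P\<close> is
      nonnegative.\<close>
    have cand_bd: "\<bar>cand j b x\<bar> \<le> max_int" "c j * x \<le> cand j b x" if "0 \<le> x" "x * x \<le> b" for x
    proof -
      have "0 \<le> P c (j - 1) (b - x * x)" using P_le(1)[of "j - 1" "b - x * x"] j b that zero_le_square[of x] by simp
      then show "c j * x \<le> cand j b x" by (simp add: cand_def)
      with cand_le[OF j that] bP[OF j(2) b] mult_nonneg_nonneg[OF nonneg that(1)] show "\<bar>cand j b x\<bar> \<le> max_int" by linarith
    qed
    have cX: "\<bar>c j * X\<bar> \<le> max_int" "\<bar>c j * X + P c (j - 1) (b - X * X)\<bar> \<le> max_int"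
       "\<bar>c j\<bar> \<le> max_int"
      using cand_bd[OF X(1) XX] mult_nonneg_nonneg[OF nonneg X(1)] nonneg max_int_coeff[of j] j by (auto simp: cand_def)
    have cand_fold: "c j * X + P c (j - Suc 0) (b - X * X) = cand j b X"
      by (simp add: cand_def)
    have sqX: "\<bar>X\<bar> \<le> max_int" "\<bar>X + 1\<bar> \<le> max_int" "\<bar>X * X\<bar> \<le> max_int" "\<bar>b - X * X\<bar> \<le> max_int"
      using le[of X] le[of "X + 1"] sq[of X] le[of "b - X * X"] X w_le XX XX0 b unfolding width_def by linarith+
    have arg: "0 \<le> reg s ''arg''" "reg s ''arg'' * reg s ''arg'' \<le> b" "\<bar>reg s ''arg''\<bar> \<le> max_int"
    proof -
      have *: "0 \<le> reg s ''arg''" "reg s ''arg'' \<le> X" using I X(3) by (auto simp: I_def)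
      then show "0 \<le> reg s ''arg''" "\<bar>reg s ''arg''\<bar> \<le> max_int" using sqX by auto
      show "reg s ''arg'' * reg s ''arg'' \<le> b" using mult_mono[OF *(2,2)] * X(1) XX by linarith
    qed
    have inv: "reg s ''arg'' \<le> int k" "\<And>x. 0 \<le> x \<Longrightarrow> x \<le> int k \<Longrightarrow> cand j b x \<le> cand j b (reg s ''arg'')"
      using I regs(5) by (auto simp: I_def)
    have all_le: "cand j b x \<le> v" if "cand j b (reg s ''arg'') \<le> v" "cand j b X \<le> v" "0 \<le> x" "x \<le> X" for x v
    proof (cases "x = X")
      case False
      then have "x \<le> int k" using that(4) X(3) by linarith
      from order_trans[OF inv(2)[OF that(3) this] that(1)] show ?thesis .
    qed (use that in simp)
    have Sk: "int (Suc k) = X" using X(3) by simp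
    have arg_le: "reg s ''arg'' \<le> X" using inv(1) X(3) by linarith
    have better: "I (Suc k) (set_reg ''x'' (X + 1) (set_reg ''arg'' X (set_reg ''best'' v (set_reg ''v'' v s))))"
      if "v = cand j b X" "cand j b (reg s ''arg'') < v" for v
      unfolding I_def Sk using that X(1) st all_le[of v] by simp
    have worse: "I (Suc k) (set_reg ''x'' (X + 1) (set_reg ''v'' v s))"
      if "\<not> cand j b (reg s ''arg'') < cand j b X" for v
      unfolding I_def Sk using that st regs(5) arg(1) arg_le all_le[of "cand j b (reg s ''arg'')"] by simp
    note bds = cX cX(2)[unfolded p(2)] cand_bd(1)[OF X(1) XX] cand_bd(1)[OF arg(1,2)]
      addr1[OF b'] addr1(2)[OF b] sqX arg(3) j0 bP[OF j1 b', unfolded p(2)]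
    note bd = bds bds[THEN abs_le_D1] j1
    show ?thesis
      by (simp add: wp_simps regs p cj st cand_fold better worse XX X(1) b bd)
  qed
  have regs0: "reg s ''j'' = int j" "reg s ''b'' = b" "reg s ''width'' = width" if "at_state j b A s" for A s
    using that by (simp_all add: at_state_def base_def)
  note bd0 = j0 addr1[OF b] addr0 bP[OF j1 b] bP[OF j1 b, simplified]
  have init: "I 0 (set_reg ''x'' 1 (set_reg ''arg'' 0 (set_reg ''best'' (P c (j - Suc 0) b) s)))"
    using s by (auto simp: I_def cand_def dest: antisym)
  \<comment> \<open>The failing test still computes \<open>(w + 1) * (w + 1)\<close>. As
    \<open>w \<le> r2\<close>, this is at most \<open>width * width\<close>, which the square in
    \<open>max_int\<close> accommodates.\<close>
  have exit: "\<not> bval (V ''x'' \<otimes> V ''x'' \<preceq> V ''b'') s \<and>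
      bounded_steps max_int (bsteps (V ''x'' \<otimes> V ''x'' \<preceq> V ''b'') s)" if "I w s" for s
    using that w(2) b w_le max_int_square[of "int w + 1"] max_int_width[of "int w + 1"]
    by (auto simp: I_def at_state_def width_def)
  have store: "at_state j b (?A + 1) (set_arr ''X'' ?A (reg s ''arg'') (set_arr ''P'' ?A (P c j b) s))
    \<and> reg s ''best'' = P c j b \<and> \<bar>reg s ''arg''\<bar> \<le> max_int"
    if I: "I w s" for s
  proof -
    let ?x = "reg s ''arg''"
    have x: "0 \<le> ?x" "?x \<le> int w" "reg s ''best'' = cand j b ?x"
      and max: "\<And>y. 0 \<le> y \<Longrightarrow> y \<le> int w \<Longrightarrow> cand j b y \<le> cand j b ?x"
      and st: "at_state j b ?A s"
      using I by (auto simp: I_def)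
    \<comment> \<open>The loop stops after \<open>w\<close>, so no admissible \<open>y\<close> has
      been missed.\<close>
    have "y \<le> int w" if "0 \<le> y" "y * y \<le> b" for y
    proof (rule ccontr)
      assume "\<not> y \<le> int w"
      then have "int w + 1 \<le> y" by simp
      from mult_mono[OF this this] that w(2) show False by simp
    qed
    moreover have "?x * ?x \<le> b" using mult_mono[OF x(2) x(2)] x(1) w(1) by simp
    ultimately have ch: "choice j b ?x" using max x j by (intro choiceI) auto
    then have best: "reg s ''best'' = P c j b" using x(3) by (simp add: choice_def)
    have "filled (?A + 1) (set_arr ''X'' ?A ?x (set_arr ''P'' ?A (P c j b) s))"
      using st b ch unfolding at_state_def by (intro filled_extend[of j b s]) auto
    with st best x(1,2) le[of ?x] w_le show ?thesis by (simp add: at_state_def width_def)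
  qed
  show ?thesis
    unfolding fill_state_def
    apply (simp add: wp_simps regs0[OF s] s b prev bd0 bd0[THEN abs_le_D1])
    \<comment> \<open>\<open>T\<close> and \<open>G\<close> are rounded up: a round takes fewer than
      50 steps and the guard takes 5.\<close>
    apply (rule wp_While_count[where I=I and L=w and T=50 and G=6])
        apply (rule init)
       apply (rule step; assumption)
      apply (rule exit; assumption)
     apply simp
    subgoal premises prems for m t
    proof -
      have st: "at_state j b ?A t" using prems(2) by (simp add: I_def)
      show ?thesis
        using prems(1) store[OF prems(2)]
        by (simp add: wp_simps regs0[OF st] bd0 bd0[THEN abs_le_D1] bP[OF j(2) b] bP[OF j(2) b, THEN abs_le_D1] b)
    qed
    done
qed

section \<open>Filling the whole table\<close>

lemma width_pos: "0 < width"
  using r2_pos by (simp add: width_def)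

lemma max_int_consts: "0 \<le> max_int" "1 \<le> max_int" "width \<le> max_int" "\<bar>width\<bar> \<le> max_int" "r2 \<le> max_int"
  "int n \<le> max_int"
  using max_int_width[of 0] max_int_width[of 1] max_int_width[of width] max_int_width[of r2]
    max_int_index[of "int n"] r2_pos by (auto simp: width_def)

text \<open>Only cells of row 0 have addresses below \<open>width\<close>, and for these
  \<open>P_0\<close> is all that is required.\<close>

lemma init_row_wp:
  assumes "base s"
  shows "wp max_int init_row (\<lambda>m t. m \<le> 20 * nat width + 10 \<and> base t \<and> filled width t) s"
proof -
  define I where "I = (\<lambda>k s. base s \<and> reg s ''b'' = int k \<and> filled (int k) s)"
  have ext: "filled (int k + 1) (set_arr ''P'' (int k) 0 s)" if "filled (int k) s" "int k \<le> r2" for k s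
    using filled_extend[of 0 "int k" s "set_arr ''P'' (int k) 0 s"] that P_0[of "int k" c] by simp
  have regs: "reg s ''r2'' = r2" "reg s ''width'' = width" if "base s" for s
    using that by (auto simp: base_def)
  have "\<not> int j * width + b < 0" if "0 \<le> b" for j b
  proof -
    have "0 \<le> int j * width" using width_pos by simp
    with that show ?thesis by linarith
  qed
  then have "filled 0 s" unfolding filled_def by blast
  then have init: "I 0 (set_reg ''b'' 0 s)" using assms by (simp add: I_def)
  show ?thesis
    unfolding init_row_def
    apply (simp add: wp_simps max_int_consts)
    apply (rule wp_While_count[where I=I and L="nat width" and T=16 and G=3])
        apply (rule init)
    subgoal premises prems for k s
    proof -
      have k: "int k \<le> r2" "int k \<le> max_int" "int k + 1 \<le> max_int" "1 + int k \<le> max_int"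
        using prems(1) max_int_width[of "int k"] max_int_width[of "int k + 1"] max_int_width[of "1 + int k"]
        by (auto simp: width_def)
      then show ?thesis
        using prems(2) ext[of k s]
        by (simp add: I_def wp_simps regs max_int_consts add.commute[of 1] r2_pos less_imp_le)
    qed
    subgoal for s
      using max_int_consts width_pos by (simp add: I_def width_def regs)
    using width_pos by (simp_all add: I_def)
qed

definition isqrt :: nat where
  "isqrt = floor_sqrt (nat r2)"

text \<open>The number of rounds depends on \<open>b\<close>. Monotonicity of the root replaces it
  by its largest value \<open>isqrt\<close>, since the loop rule asks for one cost bound that is
  valid in every round of the loop over \<open>b\<close>.\<close>

lemma fill_state_wp':
  assumes "1 \<le> j" "j \<le> n" "0 \<le> b" "b \<le> r2" "at_state j b (int j * width + b) s"
  shows "wp max_int fill_state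
    (\<lambda>m t. m \<le> 100 * (isqrt + 1) \<and> at_state j b (int j * width + b + 1) t) s"
proof -
  let ?w = "floor_sqrt (nat b)"
  have "?w\<^sup>2 \<le> nat b" "nat b < (Suc ?w)\<^sup>2" using Suc_floor_sqrt_power2_gt by simp_all
  then have "int (?w\<^sup>2) \<le> b" "b < int ((Suc ?w)\<^sup>2)"
    using assms(3) by linarith+
  then have w: "int ?w * int ?w \<le> b" "b < (int ?w + 1) * (int ?w + 1)"
    by (simp_all add: power2_eq_square algebra_simps)
  have "?w \<le> isqrt"
    unfolding isqrt_def using assms by (intro mono_floor_sqrt') auto
  then show ?thesis
    using fill_state_wp[OF assms(1-4) w assms(5)] by (elim wp_mono) auto
qed

lemma fill_table_wp:
  assumes "base s" "filled width s"
  shows "wp max_int fill_table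
    (\<lambda>m t. m \<le> n * (nat width * (100 * isqrt + 120) + 20) + 10 \<and>
      base t \<and> filled ((int n + 1) * width) t) s"
proof -
  \<comment> \<open>Row 0 is already present, so \<open>k\<close> rounds complete the rows 0 to
    \<open>k\<close>. Changing rows is only a matter of rewriting: the end address
    \<open>j * width + width\<close> of row \<open>j\<close> is the start address of row
    \<open>j + 1\<close>.\<close>
  define I where "I = (\<lambda>k s. base s \<and> reg s ''j'' = int k + 1 \<and> filled ((int k + 1) * width) s)"
  define J where "J = (\<lambda>j k s. at_state j (int k) (int j * width + int k) s)"
  have base_regs: "reg s ''r2'' = r2" "reg s ''n'' = int n" if "base s" for s
    using that by (auto simp: base_def)
  have regs: "reg s ''r2'' = r2" "reg s ''b'' = b" "reg s ''j'' = int j" if "at_state j b A s" for s j b A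
    using that by (auto simp: at_state_def base_def)
  have inner: "wp max_int (WHILE V ''b'' \<preceq> V ''r2'' DO (fill_state ;; ''b'' ::= V ''b'' \<oplus> N 1))
     (\<lambda>m t. m \<le> nat width * (100 * isqrt + 110) + 3 \<and> at_state j width (int (Suc j) * width) t) s"
    if j: "1 \<le> j" "j \<le> n" and init: "J j 0 s" for j s
  proof (rule wp_While_count[where I="J j" and L="nat width" and T="100 * isqrt + 105" and G=3])
    show "J j 0 s" by (rule init)
  next
    fix k s assume k: "k < nat width" and J: "J j k s"
    then have st: "at_state j (int k) (int j * width + int k) s" by (simp add: J_def)
    have k': "int k \<le> r2" using k by (simp add: width_def)
    have "wp max_int (fill_state ;; ''b'' ::= V ''b'' \<oplus> N 1)
       (\<lambda>m t. m \<le> 100 * isqrt + 105 \<and> J j (Suc k) t) s"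
      unfolding wp_Seq
      apply (rule wp_mono[OF fill_state_wp'[OF j _ k' st]])
       apply simp
      using max_int_width[of "int k"] max_int_width[of "int k + 1"] k' max_int_consts
      by (auto simp: wp_simps regs width_def J_def) (auto simp: at_state_def algebra_simps)
    then show "bval (V ''b'' \<preceq> V ''r2'') s \<and> bounded_steps max_int (bsteps (V ''b'' \<preceq> V ''r2'') s) \<and>
      wp max_int (fill_state ;; ''b'' ::= V ''b'' \<oplus> N 1) (\<lambda>m t. m \<le> 100 * isqrt + 105 \<and> J j (Suc k) t) s"
      using max_int_consts k' r2_pos by (simp add: regs[OF st])
  next
    fix s assume "J j (nat width) s"
    then show "\<not> bval (V ''b'' \<preceq> V ''r2'') s \<and> bounded_steps max_int (bsteps (V ''b'' \<preceq> V ''r2'') s)"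
      using max_int_consts width_pos r2_pos regs[of j width _ s] unfolding J_def by (auto simp: width_def)
  next
    fix m t assume "m \<le> nat width * (100 * isqrt + 105 + 3) + 3" "J j (nat width) t"
    then show "m \<le> nat width * (100 * isqrt + 110) + 3 \<and> at_state j width (int (Suc j) * width) t"
      using width_pos by (simp add: J_def algebra_simps)
  qed simp
  show ?thesis
    unfolding fill_table_def
    apply (simp add: wp_simps max_int_consts)
    apply (rule wp_While_count[where I=I and L=n and T="nat width * (100 * isqrt + 110) + 12" and G=3])
    subgoal using assms by (simp add: I_def)
    subgoal premises prems for k s
    proof -
      note I = prems(2)[unfolded I_def]
      have "J (Suc k) 0 (set_reg ''b'' 0 s)"
        using I by (simp add: J_def at_state_def add.commute)
      note in' = inner[OF _ _ this]
      have k: "Suc k \<le> n" using prems(1) by simp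
      have nn: "int k + 1 \<le> max_int" "int k + 2 \<le> max_int"
        using max_int_index[of "int k + 1"] max_int_index[of "int k + 2"] prems(1) by auto
      show ?thesis
        apply (simp add: wp_simps base_regs I max_int_consts nn k)
        using k apply simp
        apply (rule wp_mono[OF in'])
          apply simp
         apply assumption
        subgoal premises prems for m t
        proof -
          have t: "base t" "reg t ''j'' = int k + 1" "filled ((int k + 2) * width) t"
            using prems(2) by (simp_all add: at_state_def add.commute)
          show ?thesis
            using prems t nn by (simp add: wp_simps max_int_consts I_def add.commute)
        qed
        done
    qed
    subgoal using max_int_index[of "int n + 1"] max_int_consts by (simp add: I_def base_regs)
    subgoal by simp
    subgoal by (auto simp: I_def algebra_simps)
    done
qed


section \<open>Backtracking\<close>

definition tracked :: "nat \<Rightarrow> state \<Rightarrow> bool" where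
  "tracked j s \<longleftrightarrow> base s \<and> filled ((int n + 1) * width) s \<and> optimum s = P c n r2 \<and>
     reg s ''j'' = int j \<and> 0 \<le> reg s ''b'' \<and> reg s ''b'' \<le> r2 \<and>
     (\<forall>i\<in>{Suc j..n}. 0 \<le> solution s i) \<and>
     P c j (reg s ''b'') + (\<Sum>i=Suc j..n. c i * solution s i) = P c n r2 \<and>
     reg s ''b'' + (\<Sum>i=Suc j..n. (solution s i)\<^sup>2) = r2"

text \<open>The stored \<open>x\<close> attains the maximum, so \<open>c (Suc j) * x\<close> leaves
  \<open>P\<close> and joins the collected value, while \<open>x * x\<close> moves from the
  remaining budget to the sum of squares. Describing \<open>t\<close> only by the components
  involved separates this balance from the execution of the loop body.\<close>

lemma tracked_step:
  assumes j: "Suc j \<le> n" and s: "tracked (Suc j) s"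
    and x: "x = arr s ''X'' (int (Suc j) * width + reg s ''b'')"
    and t: "base t" "optimum t = optimum s" "reg t ''j'' = int j" "reg t ''b'' = reg s ''b'' - x * x"
      "solution t = (solution s)(Suc j := x)" "arr t ''P'' = arr s ''P''" "arr t ''X'' = arr s ''X''"
  shows "tracked j t" "choice (Suc j) (reg s ''b'') x"
proof -
  let ?b = "reg s ''b''"
  have b: "0 \<le> ?b" "?b \<le> r2" using s by (auto simp: tracked_def)
  have "int (Suc j) * width + ?b < int n * width + width"
  proof -
    have "int (Suc j) * width \<le> int n * width"
      using j width_pos by (intro mult_right_mono) auto
    moreover have "?b < width" using b(2) by (simp add: width_def)
    ultimately show ?thesis by linarith
  qed
  then have "int (Suc j) * width + ?b < (int n + 1) * width"
    by (simp add: algebra_simps)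
  with s b show ch: "choice (Suc j) ?b x"
    unfolding x by (intro filledD(2)[of "(int n + 1) * width"]) (auto simp: tracked_def)
  \<comment> \<open>A general \<open>f\<close> serves both the sum of values and the sum of
    squares.\<close>
  have sums: "(\<Sum>i=Suc j..n. f i (solution t i)) = f (Suc j) x + (\<Sum>i=Suc (Suc j)..n. f i (solution s i))"
    for f :: "nat \<Rightarrow> int \<Rightarrow> int"
    using j t(5) by (simp add: sum.atLeast_Suc_atMost)
  have "filled ((int n + 1) * width) t"
    using s t(6,7) by (simp add: tracked_def filled_def)
  moreover have "0 \<le> ?b - x * x" "?b - x * x \<le> r2"
    using ch b zero_le_square[of x] unfolding choice_def by linarith+
  moreover have "\<forall>i\<in>{Suc j..n}. 0 \<le> solution t i"
    using s ch t(5) by (auto simp: tracked_def choice_def)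
  moreover have "P c j (?b - x * x) + (\<Sum>i=Suc j..n. c i * solution t i) = P c n r2"
    using s ch sums[of "\<lambda>i y. c i * y"] by (simp add: tracked_def choice_def cand_def)
  moreover have "?b - x * x + (\<Sum>i=Suc j..n. (solution t i)\<^sup>2) = r2"
    using s sums[of "\<lambda>i y. y\<^sup>2"] by (simp add: tracked_def power2_eq_square)
  ultimately show "tracked j t"
    using t s by (simp add: tracked_def)
qed

lemma backtrack_wp:
  assumes "base s" "filled ((int n + 1) * width) s" "optimum s = P c n r2"
  shows "wp max_int backtrack (\<lambda>m t. m \<le> 50 * n + 10 \<and> tracked 0 t) s"
proof -
  have regs: "reg s ''n'' = int n" "reg s ''r2'' = r2" "reg s ''width'' = width" if "base s" for s
    using that by (auto simp: base_def)
  have init: "tracked n (set_reg ''b'' r2 (set_reg ''j'' (int n) s))"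
    using assms r2_pos by (auto simp: tracked_def optimum_def)
  show ?thesis
    unfolding backtrack_def
    apply (simp add: wp_simps regs[OF assms(1)] max_int_consts r2_pos less_imp_le)
    \<comment> \<open>The program counts \<open>j\<close> down whereas the loop rule counts rounds
      up, hence \<open>n - k\<close>.\<close>
    apply (rule wp_While_count[where I="\<lambda>k. tracked (n - k)" and L=n and T=40 and G=3])
    subgoal using init by simp
    subgoal premises prems for k s
    proof -
      obtain j where nk: "n - k = Suc j" using prems(1) by (metis Suc_diff_Suc)
      then have nk': "n - Suc k = j" and j: "Suc j \<le> n" by simp_all
      have s: "tracked (Suc j) s" using prems(2) nk by simp
      define b where "b = reg s ''b''"
      define x where "x = arr s ''X'' (int (Suc j) * width + b)"
      let ?t = "set_reg ''j'' (int j) (set_reg ''b'' (b - x * x) (set_arr ''sol'' (int j + 1) x (set_reg ''x'' x s)))"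
      have *: "base s" "reg s ''j'' = int j + 1" "0 \<le> b" "b \<le> r2"
        using s by (auto simp: tracked_def b_def)
      have t: "tracked j ?t" "choice (Suc j) b x"
        using tracked_step[OF j s, of x ?t] *(1) by (auto simp: x_def b_def optimum_def solution_def fun_eq_iff)
      have "0 \<le> x" "x * x \<le> b" "x \<le> b" using t(2) le_square[of x] by (auto simp: choice_def)
      have x_arr: "arr s ''X'' ((int j + 1) * width + b) = x"
        by (simp add: x_def add.commute)
      have addr: "0 \<le> (int j + 1) * width" "(int j + 1) * width \<le> max_int"
        "0 \<le> (int j + 1) * width + b" "(int j + 1) * width + b \<le> max_int"
        using max_int_addr[OF j, of 0] max_int_addr[OF j *(4)] width_pos *(3) r2_pos
        by (simp_all add: add.commute)
      have sq: "x * x \<le> max_int" "x \<le> max_int" "b - x * x \<le> max_int" "b \<le> max_int"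
        using \<open>x \<le> b\<close> \<open>x * x \<le> b\<close> *(3,4) max_int_consts(5) zero_le_square[of x] by linarith+
      have ij: "int j + 1 \<le> max_int" "int j \<le> max_int"
        using max_int_index[of "int j + 1"] max_int_index[of "int j"] j by simp_all
      show ?thesis
        unfolding nk'
        using t(1) \<open>0 \<le> x\<close> \<open>x * x \<le> b\<close>
        by (simp add: wp_simps regs[OF *(1)] *(2-4) b_def[symmetric] max_int_consts addr sq ij x_arr)
    qed
    subgoal using max_int_consts by (simp add: tracked_def)
    subgoal by simp
    subgoal by simp
    done
qed

section \<open>The complete run and its number of steps\<close>

lemma knapsack_dp_wp:
  "wp max_int knapsack_dp
    (\<lambda>m t. m \<le> nat width * 20 + n * (nat width * (100 * isqrt + 120) + 20) + 50 * n + 60 \<and> tracked 0 t)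
    (input n c r2)"
proof -
  let ?s = "set_reg ''width'' (r2 + 1) (input n c r2)"
  have s: "base ?s" by (simp add: base_def input_def width_def)
  have addr: "int n * width + r2 \<le> max_int" "int n * width \<le> max_int"
    using max_int_addr[of n r2] max_int_addr[of n 0] r2_pos by auto
  have less: "int n * width + r2 < (int n + 1) * width"
    by (simp add: width_def algebra_simps)
  have [simp]: "reg (input n c r2) ''r2'' = r2" by (simp add: input_def)
  have r2: "0 \<le> r2" "0 \<le> r2 + 1" "0 \<le> int n * width" "0 \<le> int n * width + r2" "r2 + 1 \<le> max_int"
    using r2_pos width_pos max_int_consts(3) by (auto simp: width_def)
  show ?thesis
    unfolding knapsack_dp_def
    apply (simp add: wp_simps max_int_consts r2)
    apply (rule wp_mono[OF init_row_wp[OF s]])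
    apply (simp only: wp_Seq)
    apply (rule wp_mono[OF fill_table_wp], simp, simp)
    subgoal premises prems for m s m' t
    proof -
      have t: "base t" "filled ((int n + 1) * width) t" using prems(2) by auto
      have regs: "reg t ''n'' = int n" "reg t ''r2'' = r2" "reg t ''width'' = width"
        using t(1) by (auto simp: base_def)
      have P: "arr t ''P'' (int n * width + r2) = P c n r2"
        using filledD(1)[OF t(2) r2(1) order_refl less] .
      have bP: "0 \<le> P c n r2" "P c n r2 \<le> max_int"
        using P_le[of n r2] max_int_value r2_pos by auto
      have t': "base (set_reg ''opt'' (P c n r2) t)"
        "filled ((int n + 1) * width) (set_reg ''opt'' (P c n r2) t)"
        "optimum (set_reg ''opt'' (P c n r2) t) = P c n r2"
        using t by (auto simp: optimum_def)
      show ?thesis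
        apply (simp add: wp_simps regs max_int_consts addr r2 P bP)
        apply (rule wp_mono[OF backtrack_wp[OF t']])
        using prems by simp
    qed
    done
qed

lemma isqrt_sq: "isqrt * isqrt \<le> nat r2"
  using floor_sqrt_power2_le[of "nat r2"] by (simp add: isqrt_def power2_eq_square)

lemma isqrt_pos: "0 < isqrt"
  using r2_pos by (simp add: isqrt_def)

text \<open>All of \<open>n\<close>, \<open>nat r2\<close> and \<open>isqrt\<close> are at least 1,
  so each lower term is absorbed by their product. With \<open>nat width \<le> 2 * nat r2\<close>
  and \<open>100 * isqrt + 120 \<le> 220 * isqrt\<close> the coefficients are 40, 440, 70 and 60,
  whose sum 610 is below 740.\<close>

lemma total_steps:
  assumes "1 \<le> n"
  shows "nat width * 20 + n * (nat width * (100 * isqrt + 120) + 20) + 50 * n + 60 \<le> 740 * (n * (nat r2 * isqrt))"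
proof -
  let ?R = "nat r2"
  have R: "1 \<le> ?R" using r2_pos by simp
  have W: "nat width \<le> 2 * ?R" using r2_pos by (simp add: width_def)
  have "1 \<le> isqrt" using isqrt_pos by simp
  have 1: "?R \<le> ?R * isqrt" using isqrt_pos by simp
  have 2: "?R * isqrt \<le> n * (?R * isqrt)" using assms by simp
  have 3: "n \<le> n * (?R * isqrt)" using R isqrt_pos by simp
  have "nat width * (100 * isqrt + 120) \<le> (2 * ?R) * (220 * isqrt)"
    using W isqrt_pos by (intro mult_mono) auto
  then have "n * (nat width * (100 * isqrt + 120)) \<le> n * ((2 * ?R) * (220 * isqrt))"
    by (rule mult_left_mono) simp
  then have 4: "n * (nat width * (100 * isqrt + 120)) \<le> 440 * (n * (?R * isqrt))"
    by (simp add: algebra_simps)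
  have "nat width * 20 + n * (nat width * (100 * isqrt + 120) + 20) + 50 * n + 60
    = nat width * 20 + n * (nat width * (100 * isqrt + 120)) + 70 * n + 60"
    by (simp add: algebra_simps)
  with W R 1 2 3 4 show ?thesis by linarith
qed

text \<open>With no coordinate left \<open>P\<close> is 0, so the collected value is the whole
  optimum, and the budget that remains is the slack in the norm constraint.\<close>

lemma tracked_0:
  assumes "tracked 0 t"
  shows "fits n r2 (solution t)" "objective c n (solution t) = P c n r2"
  using assms by (auto simp: tracked_def fits_def objective_def P_0)

lemma filled_table:
  assumes "filled ((int n + 1) * width) t" "j \<le> n" "0 \<le> b" "b \<le> r2"
  shows "table r2 t j b = P c j b"
proof -
  have "int j * width \<le> int n * width" using assms(2) width_pos by (intro mult_right_mono) auto
  then have "int j * width + b < (int n + 1) * width"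
    using assms(4) by (simp add: width_def algebra_simps)
  from filledD(1)[OF assms(1,3,4) this] show ?thesis by (simp add: table_def width_def)
qed

lemma fits_feasible:
  assumes "fits n r2 x" "objective c n x = P c n r2"
  shows "is_arg_max (objective c n) (\<lambda>x. x \<in> feasible n r2) x"
  using assms P_upper[OF c_nonneg[OF order_refl]] by (auto simp: is_arg_max_def feasible_eq not_less)

section \<open>Bit lengths and bit time\<close>

lemma max_int_le_power:
  shows "max_int \<le> 2 ^ (4 * enc_length n c r2 + 2)"
proof -
  let ?L = "enc_length n c r2"
  have less: "z < 2 ^ bits z" if "0 \<le> z" for z
  proof -
    have "z < 2 ^ nat (bitlen z)"
      using bitlen_bounds[of z] that by (cases "z = 0") auto
    also have "\<dots> \<le> 2 ^ bits z" using that by (simp add: bits_def)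
    finally show ?thesis .
  qed
  \<comment> \<open>Each coefficient takes at least its sign bit, so the dimension is bounded by the
    encoding length.\<close>
  have sum_L: "n \<le> (\<Sum>i=1..n. bits (c i))"
    using sum_mono[of "{1..n}" "\<lambda>_. 1::nat" "\<lambda>i. bits (c i)"] by (simp add: bits_def)
  then have "n \<le> ?L" by (simp add: enc_length_def)
  then have n: "int n \<le> int ?L" by simp
  have r2_L: "bits r2 \<le> ?L" by (simp add: enc_length_def)
  have c_L: "c i \<le> 2 ^ ?L" if "i \<in> {1..n}" for i
  proof -
    have "c i < 2 ^ bits (c i)" using less c_pos that by (simp add: less_imp_le)
    also have "bits (c i) \<le> ?L"
      using member_le_sum[of i "{1..n}" "\<lambda>i. bits (c i)"] that by (simp add: enc_length_def)
    then have "(2::int) ^ bits (c i) \<le> 2 ^ ?L" by simp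
    finally show ?thesis by simp
  qed
  \<comment> \<open>The strict bound on \<open>r2\<close> absorbs the 1 in
    \<open>width = r2 + 1\<close>.\<close>
  have "width \<le> 2 ^ bits r2" using less[of r2] r2_pos by (simp add: width_def)
  also have "\<dots> \<le> (2::int) ^ ?L" using r2_L by simp
  finally have width: "width\<^sup>2 \<le> (2 ^ ?L)\<^sup>2" using width_pos by (intro power_mono) auto
  have L: "int ?L \<le> 2 ^ ?L"
    using less_exp[of ?L] by (metis less_imp_le of_nat_le_iff of_nat_numeral of_nat_power)
  have "1 \<le> ?L" by (simp add: enc_length_def bits_def)
  then have two: "(2::int) \<le> 2 ^ ?L" using power_increasing[of 1 ?L "2::int"] by simp
  have "(\<Sum>i=1..n. c i) \<le> int n * 2 ^ ?L"
    using sum_mono[of "{1..n}" c "\<lambda>_. 2 ^ ?L"] c_L by simp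
  also have "\<dots> \<le> 2 ^ ?L * 2 ^ ?L" using order_trans[OF n L] by (intro mult_right_mono) auto
  finally have "(\<Sum>i=1..n. c i) + int n + 2 \<le> 2 ^ ?L * 2 ^ ?L + 2 ^ ?L + 2 ^ ?L"
    using n L two by linarith
  also have "\<dots> \<le> 4 * (2 ^ ?L * 2 ^ ?L)"
  proof -
    have "(2::int) ^ ?L * 1 \<le> 2 ^ ?L * 2 ^ ?L" using two by (intro mult_left_mono) auto
    with two show ?thesis by linarith
  qed
  \<comment> \<open>The exponent \<open>4 * ?L + 2\<close> consists of \<open>2 * ?L\<close> from
    the sum of coefficients, \<open>2 * ?L\<close> from the square of \<open>width\<close>, and 2
    from the factor 4.\<close>
  finally have "max_int \<le> 4 * (2 ^ ?L * 2 ^ ?L) * (2 ^ ?L)\<^sup>2"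
    unfolding max_int_def using width sum_c_nonneg by (intro mult_mono) auto
  also have "\<dots> = 2 ^ (4 * ?L + 2)"
    by (simp add: power_add power_mult power2_eq_square flip: power_mult_distrib)
  finally show ?thesis .
qed

text \<open>The bound \<open>2 ^ (4 * enc_length n c r2 + 2)\<close> is not strict, which costs one
  more binary digit; the sign bit then gives \<open>+ 4\<close>.\<close>

lemma bits_le:
  assumes "\<bar>z\<bar> \<le> max_int"
  shows "bits z \<le> 4 * enc_length n c r2 + 4"
proof -
  have "(2::int) ^ (4 * enc_length n c r2 + 2) < 2 ^ (4 * enc_length n c r2 + 3)"
    by (intro power_strict_increasing) auto
  with assms max_int_le_power have "\<bar>z\<bar> < 2 ^ nat (int (4 * enc_length n c r2 + 3))"
    unfolding nat_int by linarith
  then have "bitlen \<bar>z\<bar> \<le> int (4 * enc_length n c r2 + 3)"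
    by (subst bitlen_le_iff_power) auto
  then show ?thesis by (simp add: bits_def)
qed

end

text \<open>A multiplication costs at most \<open>B\<^sup>2\<close> and every other step at most
  \<open>2 * B\<close>. Here \<open>1 \<le> B\<close>, because each step involves an integer and
  that integer has a sign bit.\<close>

lemma bit_time_le:
  assumes "\<And>e z. e \<in> set tr \<Longrightarrow> z \<in> step_ints e \<Longrightarrow> bits z \<le> B"
  shows "bit_time tr \<le> length tr * (2 * B\<^sup>2)"
proof -
  have pos: "1 \<le> bits z" for z by (simp add: bits_def)
  have "step_cost e \<le> 2 * B\<^sup>2" if "e \<in> set tr" for e
  proof -
    have sum: "bits u + bits v \<le> 2 * B\<^sup>2" and prod: "bits u * bits v \<le> B\<^sup>2"
      if "bits u \<le> B" "bits v \<le> B" for u v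
    proof -
      have "B * 1 \<le> B * B" using order_trans[OF pos that(1)] by (intro mult_left_mono) auto
      with that show "bits u + bits v \<le> 2 * B\<^sup>2" unfolding power2_eq_square by linarith
      show "bits u * bits v \<le> B\<^sup>2" using mult_mono[OF that] by (simp add: power2_eq_square)
    qed
    show ?thesis
    proof (cases e)
      case (Arith f u v w)
      then have "bits u \<le> B" "bits v \<le> B" using assms[OF that] by auto
      from sum[OF this] prod[OF this] show ?thesis by (simp add: Arith)
    next
      case (Access k v)
      then show ?thesis using sum assms[OF that] by simp
    next
      case (Move v)
      then show ?thesis using sum[of v v] assms[OF that] by simp
    qed
  qed
  then show ?thesis
    unfolding bit_time_def using sum_list_mono[of tr step_cost "\<lambda>_. 2 * B\<^sup>2"]
    by (simp add: sum_list_triv)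
qed

theorem proposition4p1:
  shows "\<exists>(K :: real) (K' :: real) (p :: nat poly) (q :: nat poly).
    \<forall>(n :: nat) (c :: nat \<Rightarrow> int) (r2 :: int) (r :: real).
      2 \<le> n \<longrightarrow> (\<forall>i\<in>{1..n}. 0 < c i) \<longrightarrow> primitive n c \<longrightarrow> 0 < r2 \<longrightarrow> r = sqrt (real_of_int r2) \<longrightarrow>
      (\<exists>tr t. exec knapsack_dp (input n c r2) tr t \<and>
        (\<forall>j\<in>{0..n}. \<forall>b\<in>{0..r2}. table r2 t j b = P c j b) \<and>
        optimum t = P c n r2 \<and>
        P c n r2 = Max (objective c n ` feasible n r2) \<and>
        is_arg_max (objective c n) (\<lambda>x. x \<in> feasible n r2) (solution t) \<and>
        objective c n (solution t) = optimum t \<and>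
        real (arith_ops tr) \<le> K * (real n * real_of_int r2 powr (3/2)) \<and>
        real n * real_of_int r2 powr (3/2) = real n * r ^ 3 \<and>
        (\<forall>e\<in>set tr. \<forall>z\<in>step_ints e. bits z \<le> poly p (enc_length n c r2)) \<and>
        real (bit_time tr) \<le> K' * (real n * r ^ 3) * real (poly q (enc_length n c r2)))"
\<comment> \<open>740 is the constant of \<open>total_steps\<close>, \<open>[:4, 4:]\<close> is the
  bit length bound of \<open>bits_le\<close>, and \<open>q\<close> is twice its square, the cost of
  one step in \<open>bit_time_le\<close>.\<close>
proof (rule exI[of _ 740], rule exI[of _ 740], rule exI[of _ "[:4, 4:]"],
    rule exI[of _ "smult 2 ([:4, 4:]\<^sup>2)"], intro allI impI)
  fix n :: nat and c :: "nat \<Rightarrow> int" and r2 :: int and r :: real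
  assume n: "2 \<le> n" and c: "\<forall>i\<in>{1..n}. 0 < c i" and r2: "0 < r2" and r: "r = sqrt (real_of_int r2)"
  interpret knapsack n c r2 by unfold_locales (use c r2 in auto)
  let ?L = "enc_length n c r2"
  obtain tr t where exec: "exec knapsack_dp (input n c r2) tr t" and tr: "bounded_steps max_int tr"
    and len: "length tr \<le> nat width * 20 + n * (nat width * (100 * isqrt + 120) + 20) + 50 * n + 60"
    and t: "tracked 0 t"
    using knapsack_dp_wp unfolding wp_def by blast
  have r_pos: "0 \<le> r" "r\<^sup>2 = real_of_int r2" using r r2 by auto
  have powr: "real_of_int r2 powr (3/2) = r ^ 3"
  proof -
    have "r ^ 3 = (real_of_int r2 powr (1/2)) ^ 3" using r r2 by (simp add: powr_half_sqrt)
    also have "\<dots> = real_of_int r2 powr (3/2)" using r2 by (simp add: powr_power)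
    finally show ?thesis by simp
  qed
  \<comment> \<open>Rounding down is harmless here:
    \<open>r2 * isqrt \<le> r2 * r = r ^ 3\<close>.\<close>
  have "real isqrt \<le> r"
  proof -
    have "real isqrt * real isqrt \<le> real_of_int r2"
      using isqrt_sq r2 by (metis of_nat_le_iff of_nat_mult of_nat_nat less_imp_le of_int_of_nat_eq)
    then show ?thesis using real_le_rsqrt[of "real isqrt"] unfolding r by (simp add: power2_eq_square)
  qed
  then have "real_of_int r2 * real isqrt \<le> real_of_int r2 * r" using r2 by (intro mult_left_mono) auto
  also have "\<dots> = r ^ 3" using r_pos(2) by (simp add: power3_eq_cube power2_eq_square)
  finally have "real n * (real_of_int r2 * real isqrt) \<le> real n * r ^ 3" by (intro mult_left_mono) auto
  moreover have "real (length tr) \<le> real (740 * (n * (nat r2 * isqrt)))"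
    using order_trans[OF len total_steps] n by (intro of_nat_mono) auto
  ultimately have len': "real (length tr) \<le> 740 * (real n * r ^ 3)" using r2 by simp
  have bits: "bits z \<le> poly [:4, 4:] ?L" if "e \<in> set tr" "z \<in> step_ints e" for e z
    using bits_le[of z] tr that by (auto simp: bounded_steps_def)
  have "real (bit_time tr) \<le> real (length tr) * real (poly (smult 2 ([:4, 4:]\<^sup>2)) ?L)"
    using bit_time_le[OF bits] by (simp add: poly_power flip: of_nat_mult)
  also have "\<dots> \<le> 740 * (real n * r ^ 3) * real (poly (smult 2 ([:4, 4:]\<^sup>2)) ?L)"
    using len' by (rule mult_right_mono) simp
  finally have time: "real (bit_time tr) \<le> 740 * (real n * r ^ 3) * real (poly (smult 2 ([:4, 4:]\<^sup>2)) ?L)" .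
  have "arith_ops tr \<le> length tr" by (simp add: arith_ops_def)
  then have ops: "real (arith_ops tr) \<le> 740 * (real n * real_of_int r2 powr (3/2))"
    using len' powr by simp
  note final = tracked_0[OF t]
  have opt: "optimum t = P c n r2" and filled: "filled ((int n + 1) * width) t"
    using t by (auto simp: tracked_def)
  show "\<exists>tr t. exec knapsack_dp (input n c r2) tr t \<and>
        (\<forall>j\<in>{0..n}. \<forall>b\<in>{0..r2}. table r2 t j b = P c j b) \<and>
        optimum t = P c n r2 \<and>
        P c n r2 = Max (objective c n ` feasible n r2) \<and>
        is_arg_max (objective c n) (\<lambda>x. x \<in> feasible n r2) (solution t) \<and>
        objective c n (solution t) = optimum t \<and>
        real (arith_ops tr) \<le> 740 * (real n * real_of_int r2 powr (3/2)) \<and>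
        real n * real_of_int r2 powr (3/2) = real n * r ^ 3 \<and>
        (\<forall>e\<in>set tr. \<forall>z\<in>step_ints e. bits z \<le> poly [:4, 4:] (enc_length n c r2)) \<and>
        real (bit_time tr) \<le> 740 * (real n * r ^ 3) * real (poly (smult 2 ([:4, 4:]\<^sup>2)) (enc_length n c r2))"
    using exec filled_table[OF filled] opt final fits_feasible[OF final] ops powr bits time
    by (intro exI[of _ tr] exI[of _ t]) (simp add: P_alt feasible_eq)
qed

end
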